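(* Let $L$ be a line in $\mathbb{K}P^3$ such that $L\cap Q(\mathbb{K})$ consists of a single point. Then $\operatorname{VAL}(L)$ is equal to one of the following two sets: (i) $\{r\}\times\sigma(l\setminus\{p\})\ \cup\ ((r,\infty)\cap\mathbb{Q})\times\mathcal{S}|_{\{p\}}\ \cup\ \{\infty\}\times\{p\}$, where $r>0$, $l$ is a line contained in $Q(\mathbb{C})$, $p\in l$, and $\sigma$ is a section of $\mathcal{S}$ over $l\setminus\{p\}$; or (ii) $\{0\}\times\varkappa^\circ(l\setminus\{p\})\ \cup\ ((0,\infty)\cap\mathbb{Q})\times\mathcal{S}|_{\{p\}}\ \cup\ \{\infty\}\times\{p\}$, where $l$ is a line in $\mathbb{C}P^3$ tangent to $Q(\mathbb{C})$ at the point $p$.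
   Context: Matrices and classes. For a $2\times 2$ matrix $B=\begin{pmatrix}a&b\\ c&d\end{pmatrix}$ write $B^{\mathbf c}=\begin{pmatrix}d&-b\\ -c&a\end{pmatrix}$; $B^*$ is the conjugate transpose. $\mathbb{C}P^3$ is the projectivization of the space of complex $2\times2$ matrices; $[B]_{\mathbb{C}^*}$ is the class of a nonzero matrix up to nonzero complex scalars, $[B]_{\mathbb{R}^*}$ its class up to nonzero real scalars. $Q(\mathbb{C})=\{[B]_{\mathbb{C}^*}:\det B=0\}$, $PSL_2(\mathbb{C})=\mathbb{C}P^3\setminus Q(\mathbb{C})$, $PSU(2)=\{[U]_{\mathbb{C}^*}:U\in SU(2)\}$. The spherical coamoeba map $\varkappa^\circ\colon PSL_2(\mathbb{C})\to PSU(2)$ sends $[A]_{\mathbb{C}^*}$ with $\det A=1$ to $[A+(A^{\mathbf c})^*]_{\mathbb{R}^*}$ (the class of the unitary factor of the polar decomposition of $A$). Circle bundle. $\mathcal{S}$ is the set of classes $[B]_{\mathbb{R}^*}$ of complex $2\times2$ matrices of rank one, with projection $\pi\colon\mathcal{S}\to Q(\mathbb{C})$, $[B]_{\mathbb{R}^*}\mapsto[B]_{\mathbb{C}^*}$; for $Z\subset Q(\mathbb{C})$, $\mathcal{S}|_Z=\pi^{-1}(Z)$, and a section of $\mathcal{S}$ over $Z$ is a continuous map $\sigma\colon Z\to\mathcal{S}$ with $\pi\circ\sigma=\mathrm{id}_Z$. Cone notation (all sets below are subsets of $\mathbb{C}P^3$). For $I\subset(0,\infty)$ and $T\subset\mathcal{S}$,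 $I\times T:=\{[e^\alpha B+e^{-\alpha}(B^{\mathbf c})^*]_{\mathbb{C}^*}:\alpha\in I,\ [B]_{\mathbb{R}^*}\in T\}$ (for $I=\{r\}$ we write $\{r\}\times T$); for $X\subset PSU(2)$, $\{0\}\times X:=X$; for $Y\subset Q(\mathbb{C})$, $\{\infty\}\times Y:=Y$. Field and valuation. $\mathbb{K}$ is the field of Puiseux series in $t$ (with $t\to\infty$) with complex coefficients, i.e. series $\sum_q a_q t^q$ with $a_q\in\mathbb{C}$ and exponents $q$ in $\frac1N\mathbb{Z}$ for some $N\ge1$ and bounded above; it is algebraically closed. $\mathbb{K}P^3$ is the projectivization of the space of $2\times 2$ matrices over $\mathbb{K}$, and $Q(\mathbb{K})\subset\mathbb{K}P^3$ the quadric $\det=0$. Every nonzero matrix $A$ over $\mathbb{K}$ can be written uniquely as $A=t^\alpha B+(\text{terms with exponents}<\alpha)$ with $\alpha\in\mathbb{Q}$ and $B$ a nonzero complex matrix. The map $\operatorname{VAL}\colon\mathbb{K}P^3\to\mathbb{C}P^3$ is: if $\det A=0$, $\operatorname{VAL}([A])=[B]_{\mathbb{C}^*}\in Q(\mathbb{C})$; if $\det A\ne0$, rescale $A$ so that $\det A=1$ (then $\alpha\ge0$), and set $\operatorname{VAL}([A])=[e^\alpha B+e^{-\alpha}(B^{\mathbf c})^*]_{\mathbb{C}^*}$ (this equals $\varkappa^\circ([B]_{\mathbb{C}^*})$ if $\alpha=0$ and lies in $\{\alpha\}\times\{[B]_{\mathbb{R}^*}\}$ if $\alpha>0$). *)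

theory Defs
  imports "HOL-Analysis.Analysis"
begin

type_synonym cmat = "complex^2^2"

definition mk2 :: "'a \<Rightarrow> 'a \<Rightarrow> 'a \<Rightarrow> 'a \<Rightarrow> 'a^2^2" where
  "mk2 a b c d = (\<chi> i j. if i = 1 then (if j = 1 then a else b) else (if j = 1 then c else d))"

definition cscale :: "complex \<Rightarrow> cmat \<Rightarrow> cmat" where
  "cscale c B = (\<chi> i j. c * B$i$j)"

definition adjc :: "cmat \<Rightarrow> cmat" where
  "adjc B = mk2 (B$2$2) (- B$1$2) (- B$2$1) (B$1$1)"

definition cstar :: "cmat \<Rightarrow> cmat" where
  "cstar B = (\<chi> i j. cnj (B$j$i))"

definition adjstar :: "cmat \<Rightarrow> cmat" where
  "adjstar B = cstar (adjc B)"

definition clsC :: "cmat \<Rightarrow> cmat set" where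
  "clsC B = {cscale c B | c. c \<noteq> 0}"

definition clsR :: "cmat \<Rightarrow> cmat set" where
  "clsR B = {cscale (complex_of_real r) B | r. r \<noteq> 0}"

definition CP3 :: "cmat set set" where
  "CP3 = {clsC B | B. B \<noteq> 0}"

definition Qc :: "cmat set set" where
  "Qc = {clsC B | B. B \<noteq> 0 \<and> det B = 0}"

definition SU2 :: "cmat set" where
  "SU2 = {U. cstar U ** U = mat 1 \<and> det U = 1}"

definition PSU2 :: "cmat set set" where
  "PSU2 = {clsC U | U. U \<in> SU2}"

text \<open>spherical coamoeba map on PSL_2(C) = CP^3 - Q(C)\<close>
definition kappa :: "cmat set \<Rightarrow> cmat set" where
  "kappa z = (let A = (SOME A. A \<in> z \<and> det A = 1) in clsC (A + adjstar A))"

definition cline :: "cmat \<Rightarrow> cmat \<Rightarrow> cmat set set" where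
  "cline B1 B2 = {clsC (cscale a B1 + cscale b B2) | a b. a \<noteq> 0 \<or> b \<noteq> 0}"

definition is_cline :: "cmat set set \<Rightarrow> bool" where
  "is_cline l \<longleftrightarrow> (\<exists>B1 B2. (\<forall>a b. cscale a B1 + cscale b B2 = 0 \<longrightarrow> a = 0 \<and> b = 0)
                      \<and> l = cline B1 B2)"

definition detpolar :: "cmat \<Rightarrow> cmat \<Rightarrow> complex" where
  "detpolar X Y = X$1$1 * Y$2$2 + X$2$2 * Y$1$1 - X$1$2 * Y$2$1 - X$2$1 * Y$1$2"

definition tangent_at :: "cmat set set \<Rightarrow> cmat set \<Rightarrow> bool" where
  "tangent_at l p \<longleftrightarrow> is_cline l \<and> p \<in> l \<and> p \<in> Qc \<and> \<not> l \<subseteq> Qc \<and>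
     (\<forall>z\<in>l. \<forall>P\<in>p. \<forall>B\<in>z. detpolar P B = 0)"

definition Sb :: "cmat set set" where
  "Sb = {clsR B | B. B \<noteq> 0 \<and> det B = 0}"

definition projS :: "cmat set \<Rightarrow> cmat set" where
  "projS s = clsC (SOME B. B \<in> s)"

definition Srest :: "cmat set set \<Rightarrow> cmat set set" where
  "Srest Z = {s \<in> Sb. projS s \<in> Z}"

definition qtop :: "'a topology \<Rightarrow> ('a \<Rightarrow> 'b) \<Rightarrow> 'b topology" where
  "qtop X q = topology (\<lambda>U. U \<subseteq> q ` topspace X \<and> openin X {x \<in> topspace X. q x \<in> U})"

definition CP3_top :: "cmat set topology" where
  "CP3_top = qtop (subtopology euclidean (- {0})) clsC"

definition S_top :: "cmat set topology" where
  "S_top = qtop (subtopology euclidean {B. B \<noteq> 0 \<and> det B = 0}) clsR"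

definition is_section :: "(cmat set \<Rightarrow> cmat set) \<Rightarrow> cmat set set \<Rightarrow> bool" where
  "is_section \<sigma> Z \<longleftrightarrow> Z \<subseteq> Qc \<and> (\<forall>z\<in>Z. \<sigma> z \<in> Sb \<and> projS (\<sigma> z) = z) \<and>
     continuous_map (subtopology CP3_top Z) S_top \<sigma>"

definition cone_set :: "real set \<Rightarrow> cmat set set \<Rightarrow> cmat set set" where
  "cone_set I T = {clsC (exp \<alpha> *\<^sub>R B + exp (- \<alpha>) *\<^sub>R adjstar B) | \<alpha> B. \<alpha> \<in> I \<and> clsR B \<in> T}"

section \<open>Puiseux series (t \<rightarrow> \<infinity>) and matrices over them\<close>

type_synonym pser = "rat \<Rightarrow> complex"
type_synonym kmat = "pser^2^2"

definition puiseux :: "pser \<Rightarrow> bool" where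
  "puiseux f \<longleftrightarrow> (\<exists>N::nat. N \<ge> 1 \<and> (\<exists>M::rat. \<forall>q. f q \<noteq> 0 \<longrightarrow> q * of_nat N \<in> \<int> \<and> q \<le> M))"

definition pzero :: pser where "pzero = (\<lambda>q. 0)"
definition pone :: pser where "pone = (\<lambda>q. if q = 0 then 1 else 0)"
definition padd :: "pser \<Rightarrow> pser \<Rightarrow> pser" where "padd f g = (\<lambda>q. f q + g q)"
definition pneg :: "pser \<Rightarrow> pser" where "pneg f = (\<lambda>q. - f q)"
definition pmul :: "pser \<Rightarrow> pser \<Rightarrow> pser" where
  "pmul f g = (\<lambda>q. \<Sum>ab\<in>{(a, b). a + b = q \<and> f a \<noteq> 0 \<and> g b \<noteq> 0}. f (fst ab) * g (snd ab))"

definition kmat_ok :: "kmat \<Rightarrow> bool" where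
  "kmat_ok A \<longleftrightarrow> (\<forall>i j. puiseux (A$i$j))"

definition kzero :: kmat where "kzero = (\<chi> i j. pzero)"
definition kadd :: "kmat \<Rightarrow> kmat \<Rightarrow> kmat" where "kadd A B = (\<chi> i j. padd (A$i$j) (B$i$j))"
definition kscale :: "pser \<Rightarrow> kmat \<Rightarrow> kmat" where "kscale c A = (\<chi> i j. pmul c (A$i$j))"
definition kdet :: "kmat \<Rightarrow> pser" where
  "kdet A = padd (pmul (A$1$1) (A$2$2)) (pneg (pmul (A$1$2) (A$2$1)))"

definition lead_exp :: "kmat \<Rightarrow> rat" where
  "lead_exp A = (GREATEST q. \<exists>i j. (A$i$j) q \<noteq> 0)"

definition lead_mat :: "kmat \<Rightarrow> cmat" where
  "lead_mat A = (\<chi> i j. (A$i$j) (lead_exp A))"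

text \<open>VAL on a (nonzero) representative matrix\<close>
definition VALm :: "kmat \<Rightarrow> cmat set" where
  "VALm A = (if kdet A = pzero then clsC (lead_mat A)
     else (let c = (SOME c. puiseux c \<and> pmul (pmul c c) (kdet A) = pone);
               A' = kscale c A;
               \<alpha> = real_of_rat (lead_exp A');
               B = lead_mat A'
           in clsC (exp \<alpha> *\<^sub>R B + exp (- \<alpha>) *\<^sub>R adjstar B)))"

text \<open>representatives of the points of the line of KP^3 spanned by M1, M2\<close>
definition kline :: "kmat \<Rightarrow> kmat \<Rightarrow> kmat set" where
  "kline M1 M2 = {kadd (kscale a M1) (kscale b M2) | a b.
      puiseux a \<and> puiseux b \<and> (a \<noteq> pzero \<or> b \<noteq> pzero)}"

definition is_kline :: "kmat \<Rightarrow> kmat \<Rightarrow> bool" where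
  "is_kline M1 M2 \<longleftrightarrow> kmat_ok M1 \<and> kmat_ok M2 \<and>
     (\<forall>a b. puiseux a \<and> puiseux b \<and> kadd (kscale a M1) (kscale b M2) = kzero
        \<longrightarrow> a = pzero \<and> b = pzero)"

definition meets_QK_once :: "kmat \<Rightarrow> kmat \<Rightarrow> bool" where
  "meets_QK_once M1 M2 \<longleftrightarrow> (\<exists>P\<in>kline M1 M2. kdet P = pzero \<and>
     (\<forall>A\<in>kline M1 M2. kdet A = pzero \<longrightarrow> (\<exists>\<nu>. puiseux \<nu> \<and> A = kscale \<nu> P)))"

end

theory Submission
  imports Defs "HOL-Computational_Algebra.Formal_Laurent_Series"
begin

text \<open>
  A line that meets the quadric only at \<open>P\<close> is tangent to it there, so after rescaling it is spanned
  by \<open>P\<close> and a matrix \<open>M\<close> with \<open>det (M + s P) = 1\<close> for every \<open>s\<close>. Normalise \<open>P\<close> to have leading exponent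
  \<open>0\<close> and leading matrix \<open>P\<^sub>0\<close>, and choose \<open>M\<close> with a zero entry where \<open>P\<^sub>0\<close> has a nonzero one. If \<open>M\<close>
  has leading exponent \<open>r\<close> and leading matrix \<open>B\<close>, then \<open>M + s P\<close> has leading exponent \<open>r\<close> and leading
  matrix \<open>B + s\<^sub>0 P\<^sub>0\<close> as long as \<open>s\<close> has order at most \<open>r\<close> (all \<open>s\<^sub>0\<close> occur), and leading term
  \<open>s\<^sub>0 P\<^sub>0 t\<^sup>q\<close> if \<open>s = s\<^sub>0 t\<^sup>q + \<dots>\<close> with \<open>q > r\<close>. Comparing leading terms in \<open>det M = 1\<close> and in the tangency
  relation puts the line through \<open>P\<^sub>0\<close> and \<open>B\<close> inside \<open>Q(\<complex>)\<close> when \<open>r > 0\<close>, and makes it tangent to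
  \<open>Q(\<complex>)\<close> at \<open>P\<^sub>0\<close> when \<open>r = 0\<close>.
\<close>

section \<open>The field of Puiseux series\<close>

unbundle no Formal_Power_Series.fps_syntax  (* its $ competes with vec_nth *)

text \<open>The Laurent series \<open>F\<close> evaluated at \<open>t\<^sup>-\<^sup>1\<^sup>/\<^sup>N\<close>: exponents are bounded above on the Puiseux side,
  below on the Laurent side.\<close>
definition ramified :: "nat \<Rightarrow> complex fls \<Rightarrow> pser" where
  "ramified N F = (\<lambda>q. if q * of_nat N \<in> \<int> then fls_nth F (- \<lfloor>q * of_nat N\<rfloor>) else 0)"

lemma ramified_of_int_div:
  assumes "N \<ge> 1"
  shows "ramified N F (of_int n / of_nat N) = fls_nth F (- n)"
  using assms by (simp add: ramified_def)

lemma ramified_nonzero_Ints: "ramified N F q \<noteq> 0 \<Longrightarrow> q * of_nat N \<in> \<int>"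
  by (auto simp: ramified_def split: if_splits)

lemma of_int_div_of_nat_cases:
  fixes q :: rat
  assumes "N \<ge> 1" "q * of_nat N \<in> \<int>"
  obtains n where "q = of_int n / of_nat N"
proof -
  obtain n where "q * of_nat N = of_int n" using assms(2) by (auto elim: Ints_cases)
  then show ?thesis using assms(1) that[of n] by (simp add: field_simps)
qed

lemma ramified_nonzero_le:
  assumes nz: "ramified N F q \<noteq> 0" and N: "N \<ge> 1"
  shows "q \<le> of_int (- fls_subdegree F) / of_nat N"
proof -
  obtain n where q: "q = of_int n / of_nat N"
    using of_int_div_of_nat_cases[OF N ramified_nonzero_Ints[OF nz]] .
  have "fls_nth F (- n) \<noteq> 0"
    using nz N by (simp add: q ramified_of_int_div)
  then have "fls_subdegree F \<le> - n" by (rule fls_subdegree_leI)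
  then show ?thesis using N by (simp add: q divide_right_mono flip: of_int_minus)
qed

lemma puiseux_ramified: "N \<ge> 1 \<Longrightarrow> puiseux (ramified N F)"
  using ramified_nonzero_Ints ramified_nonzero_le unfolding puiseux_def by blast

text \<open>The upper bound \<open>M\<close> on the exponents becomes a lower bound on the reindexed
  sequence \<open>n \<mapsto> f (- n / N)\<close>, which is what makes it a Laurent series.\<close>

lemma eq_ramifiedI:
  assumes N: "N \<ge> 1" and f: "\<And>q. f q \<noteq> 0 \<Longrightarrow> q * of_nat N \<in> \<int> \<and> q \<le> M"
  shows "\<exists>F. f = ramified N F"
proof -
  define F where "F = Abs_fls (\<lambda>n. f (of_int (- n) / of_nat N))"
  have "f (of_int (- n) / of_nat N) = 0" if "n < - \<lceil>M * of_nat N\<rceil>" for n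
  proof (rule ccontr)
    assume "f (of_int (- n) / of_nat N) \<noteq> 0"
    then have "of_int (- n) / of_nat N \<le> M" using f by blast
    then have "of_int (- n) \<le> M * of_nat N" using N by (simp add: field_simps)
    then have "- n \<le> \<lceil>M * of_nat N\<rceil>" by linarith
    then show False using that by linarith
  qed
  then have nth: "fls_nth F n = f (of_int (- n) / of_nat N)" for n
    unfolding F_def by (intro nth_Abs_fls_lower_bound) blast
  have "f q = ramified N F q" for q
  proof (cases "q * of_nat N \<in> \<int>")
    case True
    obtain n where "q = of_int n / of_nat N"
      using of_int_div_of_nat_cases[OF N True] .
    then show ?thesis using N by (simp add: ramified_of_int_div nth)
  next
    case False
    then have "f q = 0" using f by blast
    with False show ?thesis by (simp add: ramified_def)
  qed
  then show ?thesis by blast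
qed

text \<open>The product of the three denominators serves all three series at once. Identities in up
  to three variables thereby reduce to identities of Laurent series.\<close>

lemma puiseux_common_ramification:
  assumes "puiseux f" "puiseux g" "puiseux h"
  obtains N F G H where "N \<ge> 1" "f = ramified N F" "g = ramified N G" "h = ramified N H"
proof -
  have mult: "q * of_nat (N * K) \<in> \<int>" "q * of_nat (K * N) \<in> \<int>" if "q * of_nat N \<in> \<int>"
    for q :: rat and N K :: nat
    using Ints_mult[OF that Ints_of_nat[of K]] by (simp_all add: ac_simps)
  obtain Nf Mf where f: "Nf \<ge> 1" "\<And>q. f q \<noteq> 0 \<Longrightarrow> q * of_nat Nf \<in> \<int> \<and> q \<le> Mf"
    using assms(1) unfolding puiseux_def by blast
  obtain Ng Mg where g: "Ng \<ge> 1" "\<And>q. g q \<noteq> 0 \<Longrightarrow> q * of_nat Ng \<in> \<int> \<and> q \<le> Mg"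
    using assms(2) unfolding puiseux_def by blast
  obtain Nh Mh where h: "Nh \<ge> 1" "\<And>q. h q \<noteq> 0 \<Longrightarrow> q * of_nat Nh \<in> \<int> \<and> q \<le> Mh"
    using assms(3) unfolding puiseux_def by blast
  have N: "Nf * Ng * Nh \<ge> 1" using f(1) g(1) h(1) by (simp add: Suc_le_eq)
  have "\<exists>F. f = ramified (Nf * Ng * Nh) F"
    by (rule eq_ramifiedI[OF N]) (use f(2) mult in blast)
  moreover have "\<exists>G. g = ramified (Nf * Ng * Nh) G"
    by (rule eq_ramifiedI[OF N]) (use g(2) mult in blast)
  moreover have "\<exists>H. h = ramified (Nf * Ng * Nh) H"
    by (rule eq_ramifiedI[OF N]) (use h(2) mult in blast)
  ultimately show ?thesis using that N by blast
qed

lemma padd_ramified: "padd (ramified N F) (ramified N G) = ramified N (F + G)"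
  by (auto simp: padd_def ramified_def)

lemma pneg_ramified: "pneg (ramified N F) = ramified N (- F)"
  by (auto simp: pneg_def ramified_def)

lemma pzero_ramified: "pzero = ramified N 0"
  by (auto simp: pzero_def ramified_def)

lemma pone_ramified: "N \<ge> 1 \<Longrightarrow> pone = ramified N 1"
  by (auto simp: pone_def ramified_def fun_eq_iff elim!: Ints_cases)

text \<open>Substituting \<open>a = - i / N\<close> and \<open>b = (n + i) / N\<close> matches the
  pairs of exponents in \<open>pmul\<close> with the terms of the Cauchy product at index
  \<open>- n\<close>.\<close>

lemma pmul_ramified:
  assumes N: "N \<ge> 1"
  shows "pmul (ramified N F) (ramified N G) = ramified N (F * G)"
proof
  fix q
  let ?f = "ramified N F" and ?g = "ramified N G"
  let ?S = "{(a, b). a + b = q \<and> ?f a \<noteq> 0 \<and> ?g b \<noteq> 0}"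
  show "pmul ?f ?g q = ramified N (F * G) q"
  proof (cases "q * of_nat N \<in> \<int>")
    case False
    have "?S = {}"
    proof -
      have "q * of_nat N \<in> \<int>" if "a + b = q" "?f a \<noteq> 0" "?g b \<noteq> 0" for a b
        using Ints_add[OF ramified_nonzero_Ints[OF that(2)] ramified_nonzero_Ints[OF that(3)]]
        by (simp flip: that(1) add: algebra_simps)
      with False show ?thesis by blast
    qed
    then have "pmul ?f ?g q = 0" unfolding pmul_def by (simp only: sum.empty)
    with False show ?thesis by (simp add: ramified_def)
  next
    case True
    obtain n where q: "q = of_int n / of_nat N"
      using of_int_div_of_nat_cases[OF N True] .
    \<comment> \<open>Outside this range one factor vanishes: \<open>F\<close> below its subdegree,
      or \<open>G\<close> at \<open>- n - i\<close> below its own.\<close>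
    let ?I = "{fls_subdegree F..- n - fls_subdegree G}"
    let ?T = "{i \<in> ?I. fls_nth F i \<noteq> 0 \<and> fls_nth G (- n - i) \<noteq> 0}"
    have "pmul ?f ?g q = (\<Sum>i\<in>?T. fls_nth F i * fls_nth G (- n - i))"
      unfolding pmul_def
    proof (rule sum.reindex_bij_witness
        [where i = "\<lambda>i. (of_int (- i) / of_nat N, of_int (n + i) / of_nat N)"
           and j = "\<lambda>(a, b). - \<lfloor>a * of_nat N\<rfloor>"])
      fix x assume "x \<in> ?S"
      then obtain a b where x: "x = (a, b)" and ab: "a + b = q" "?f a \<noteq> 0" "?g b \<noteq> 0" by blast
      obtain k where k: "a = of_int k / of_nat N"
        using of_int_div_of_nat_cases[OF N ramified_nonzero_Ints[OF ab(2)]] .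
      obtain m where m: "b = of_int m / of_nat N"
        using of_int_div_of_nat_cases[OF N ramified_nonzero_Ints[OF ab(3)]] .
      have "of_int (k + m) = (of_int n :: rat)"
        using ab(1) N by (simp add: k m q field_simps)
      then have km: "n = k + m" by (simp only: of_int_eq_iff)
      have nz: "fls_nth F (- k) \<noteq> 0" "fls_nth G (- m) \<noteq> 0"
        using ab N by (simp_all add: k m ramified_of_int_div)
      then have le: "fls_subdegree F \<le> - k" "fls_subdegree G \<le> - m"
        by (auto intro: fls_subdegree_leI)
      show "(\<lambda>i. (of_int (- i) / of_nat N, of_int (n + i) / of_nat N))
          ((\<lambda>(a, b). - \<lfloor>a * of_nat N\<rfloor>) x) = x"
        using N by (simp add: x k m km)
      show "(\<lambda>(a, b). - \<lfloor>a * of_nat N\<rfloor>) x \<in> ?T"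
        using N nz le by (simp add: x k m km)
      show "fls_nth F ((\<lambda>(a, b). - \<lfloor>a * of_nat N\<rfloor>) x) *
          fls_nth G (- n - (\<lambda>(a, b). - \<lfloor>a * of_nat N\<rfloor>) x) = ?f (fst x) * ?g (snd x)"
        using N by (simp add: x k m km ramified_of_int_div)
    next
      fix i assume i: "i \<in> ?T"
      show "(\<lambda>(a, b). - \<lfloor>a * of_nat N\<rfloor>)
          (of_int (- i) / of_nat N, of_int (n + i) / of_nat N) = i"
        using N by simp
      have "?f (of_int (- i) / of_nat N) \<noteq> 0" "?g (of_int (n + i) / of_nat N) \<noteq> 0"
        using i N by (simp_all only: ramified_of_int_div) (simp_all add: minus_add_distrib)
      moreover have "of_int (- i) / of_nat N + of_int (n + i) / of_nat N = q"
        by (simp add: q add_divide_distrib)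
      ultimately show "(of_int (- i) / of_nat N, of_int (n + i) / of_nat N) \<in> ?S" by blast
    qed
    also have "\<dots> = (\<Sum>i\<in>?I. fls_nth F i * fls_nth G (- n - i))"
      by (rule sum.mono_neutral_left) auto
    also have "\<dots> = ramified N (F * G) q"
      using N by (simp add: q ramified_of_int_div fls_times_nth(2))
    finally show ?thesis .
  qed
qed

section \<open>Closure, ring laws, inverses and square roots\<close>

lemma puiseux_pzero: "puiseux pzero"
  using puiseux_ramified[of 1 0] by (simp add: pzero_ramified[of 1])

lemma puiseux_pone: "puiseux pone"
  using puiseux_ramified[of 1 1] by (simp add: pone_ramified[of 1])

lemma puiseux_padd:
  assumes "puiseux f" "puiseux g"
  shows "puiseux (padd f g)"
  using assms assms(2)
  by (rule puiseux_common_ramification) (simp add: padd_ramified puiseux_ramified)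

lemma puiseux_pneg:
  assumes "puiseux f"
  shows "puiseux (pneg f)"
  using assms assms assms
  by (rule puiseux_common_ramification) (simp add: pneg_ramified puiseux_ramified)

lemma puiseux_pmul:
  assumes "puiseux f" "puiseux g"
  shows "puiseux (pmul f g)"
  using assms assms(2)
  by (rule puiseux_common_ramification) (simp add: pmul_ramified puiseux_ramified)

lemma pmul_assoc:
  assumes "puiseux f" "puiseux g" "puiseux h"
  shows "pmul (pmul f g) h = pmul f (pmul g h)"
  using assms by (rule puiseux_common_ramification) (simp add: pmul_ramified mult.assoc)

lemma pmul_commute:
  assumes "puiseux f" "puiseux g"
  shows "pmul f g = pmul g f"
  using assms assms(2)
  by (rule puiseux_common_ramification) (simp add: pmul_ramified mult.commute)

lemma pmul_padd_distrib:
  assumes "puiseux f" "puiseux g" "puiseux h"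
  shows "pmul (padd f g) h = padd (pmul f h) (pmul g h)"
  using assms
  by (rule puiseux_common_ramification) (simp add: pmul_ramified padd_ramified distrib_right)

lemma pmul_pone:
  assumes "puiseux f"
  shows "pmul pone f = f"
  using assms assms assms
  by (rule puiseux_common_ramification) (simp add: pone_ramified pmul_ramified)

lemma pmul_inverse_ex:
  assumes "puiseux f" "f \<noteq> pzero"
  obtains g where "puiseux g" "pmul f g = pone"
proof -
  obtain N F where N: "N \<ge> 1" and F: "f = ramified N F"
    using assms(1) assms(1) assms(1) by (rule puiseux_common_ramification)
  have "F \<noteq> 0" using assms(2) by (auto simp: F pzero_ramified[of N])
  then have "pmul f (ramified N (inverse F)) = pone"
    using N by (simp add: F pmul_ramified pone_ramified[OF N])
  with that puiseux_ramified[OF N] show ?thesis by blast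
qed

text \<open>Doubling the ramification index makes the order of the Laurent series even, so that the
  square root of its unit part lifts.\<close>
lemma psqrt_ex:
  assumes f: "puiseux f" and nz: "f \<noteq> pzero"
  obtains g where "puiseux g" "pmul g g = f"
proof -
  obtain N M where N: "N \<ge> 1" and NM: "\<And>q. f q \<noteq> 0 \<Longrightarrow> q * of_nat N \<in> \<int> \<and> q \<le> M"
    using f unfolding puiseux_def by blast
  have N2: "2 * N \<ge> 1" using N by simp
  have "\<exists>F. f = ramified (2 * N) F"
  proof (rule eq_ramifiedI[OF N2])
    show "q * of_nat (2 * N) \<in> \<int> \<and> q \<le> M" if "f q \<noteq> 0" for q
      using NM[OF that] Ints_mult[of 2 "q * of_nat N"] by (simp add: ac_simps)
  qed
  then obtain F where F: "f = ramified (2 * N) F" ..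
  have F0: "F \<noteq> 0" using nz by (auto simp: F pzero_ramified[of "2 * N"])
  define d where "d = fls_subdegree F"
  \<comment> \<open>The exponent \<open>- d / (2 * N)\<close> occurs in \<open>f\<close>, whose
    exponents are all multiples of \<open>1 / N\<close>; this forces \<open>d\<close> to be
    even.\<close>
  have "f (of_int (- d) / of_nat (2 * N)) \<noteq> 0"
    using F0 by (simp only: F ramified_of_int_div[OF N2]) (simp add: d_def)
  then have "of_int (- d) / of_nat (2 * N) * of_nat N \<in> (\<int> :: rat set)" using NM by blast
  then have "of_int d / 2 \<in> (\<int> :: rat set)"
    using N by (simp add: field_simps)
  then obtain k where "of_int d / 2 = (of_int k :: rat)" by (auto elim: Ints_cases)
  then have "of_int d = (of_int (2 * k) :: rat)" by simp
  then have dk: "d = 2 * k" by (simp only: of_int_eq_iff)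
  define g where "g = fls_base_factor_to_fps F"
  have Fg: "F = fls_shift (- d) (fps_to_fls g)"
    using F0 by (intro fls_eqI) (auto simp: g_def d_def)
  have g0: "fps_nth g 0 \<noteq> 0"
    using F0 by (simp add: g_def)
  define h where "h = fps_radical (\<lambda>_. csqrt) 2 g"
  have "csqrt (fps_nth g 0) ^ Suc 1 = fps_nth g 0"
    using power2_csqrt[of "fps_nth g 0"] by (simp only: Suc_1)
  then have "h ^ 2 = g"
    using power_radical[where r = "\<lambda>_. csqrt" and k = 1 and a = g, OF g0]
    unfolding h_def Suc_1 by blast
  then have "F = fls_shift (- k) (fps_to_fls h) * fls_shift (- k) (fps_to_fls h)"
    by (simp add: Fg dk fls_shifted_times_simps power2_eq_square flip: fls_times_fps_to_fls)
  then show ?thesis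
    using that[OF puiseux_ramified[OF N2]] by (simp add: F pmul_ramified[OF N2])
qed

section \<open>Puiseux series as a type of class \<open>field\<close>\<close>

typedef puis = "{f. puiseux f}"
  using puiseux_pzero by blast

setup_lifting type_definition_puis

instantiation puis :: comm_ring_1
begin

lift_definition zero_puis :: puis is pzero by (rule puiseux_pzero)
lift_definition one_puis :: puis is pone by (rule puiseux_pone)
lift_definition plus_puis :: "puis \<Rightarrow> puis \<Rightarrow> puis" is padd by (rule puiseux_padd)
lift_definition uminus_puis :: "puis \<Rightarrow> puis" is pneg by (rule puiseux_pneg)
lift_definition minus_puis :: "puis \<Rightarrow> puis \<Rightarrow> puis" is "\<lambda>f g. padd f (pneg g)"
  by (intro puiseux_padd puiseux_pneg)
lift_definition times_puis :: "puis \<Rightarrow> puis \<Rightarrow> puis" is pmul by (rule puiseux_pmul)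

instance
proof
  fix a b c :: puis
  show "a * b = b * a" by transfer (rule pmul_commute)
  show "a * b * c = a * (b * c)" by transfer (rule pmul_assoc)
  show "1 * a = a" by transfer (rule pmul_pone)
  show "(a + b) * c = a * c + b * c" by transfer (rule pmul_padd_distrib)
  show "a + b + c = a + (b + c)" by transfer (simp add: padd_def add.assoc)
  show "a + b = b + a" by transfer (simp add: padd_def add.commute)
  show "0 + a = a" by transfer (simp add: padd_def pzero_def)
  show "- a + a = 0" by transfer (simp add: padd_def pneg_def pzero_def)
  show "a - b = a + - b" by transfer simp
  show "0 \<noteq> (1 :: puis)" by transfer (auto simp: pzero_def pone_def fun_eq_iff)
qed

end

instantiation puis :: inverse
begin

definition inverse_puis :: "puis \<Rightarrow> puis" where
  "inverse_puis x = (if x = 0 then 0 else SOME y. x * y = 1)"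
definition divide_puis :: "puis \<Rightarrow> puis \<Rightarrow> puis" where
  "divide_puis x y = x * inverse y"

instance ..

end

instance puis :: field
proof
  fix a b :: puis
  show "a / b = a * inverse b" by (rule divide_puis_def)
  show "inverse (0 :: puis) = 0" by (simp add: inverse_puis_def)
  assume "a \<noteq> 0"
  moreover from this have "\<exists>y. a * y = 1" by transfer (blast elim: pmul_inverse_ex)
  ultimately have "a * inverse a = 1" using someI_ex[of "\<lambda>y. a * y = 1"] by (simp add: inverse_puis_def)
  then show "inverse a * a = 1" by (simp only: mult.commute)
qed

lemma puis_sqrt_ex: "x \<noteq> 0 \<Longrightarrow> \<exists>y. y * y = (x :: puis)"
  by transfer (blast elim: psqrt_ex)

section \<open>Leading terms\<close>

text \<open>\<open>x = b t\<^sup>\<alpha> + (terms with exponents < \<alpha>)\<close>, where \<open>b = 0\<close> is allowed.\<close>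
definition leading :: "rat \<Rightarrow> puis \<Rightarrow> complex \<Rightarrow> bool" where
  "leading \<alpha> x b \<longleftrightarrow> (\<forall>q>\<alpha>. Rep_puis x q = 0) \<and> Rep_puis x \<alpha> = b"

lemma leading_0_iff: "leading \<alpha> 0 b \<longleftrightarrow> b = 0"
  by (auto simp: leading_def zero_puis.rep_eq pzero_def)

lemma leading_1_iff: "leading \<alpha> 1 b \<longleftrightarrow> \<alpha> \<ge> 0 \<and> b = (if \<alpha> = 0 then 1 else 0)"
  by (auto simp: leading_def one_puis.rep_eq pone_def not_le)

lemma leading_below: "leading \<alpha> x b \<Longrightarrow> \<alpha> < \<beta> \<Longrightarrow> leading \<beta> x 0"
  by (auto simp: leading_def)

lemma leading_add: "leading \<alpha> x b \<Longrightarrow> leading \<alpha> y c \<Longrightarrow> leading \<alpha> (x + y) (b + c)"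
  by (simp add: leading_def plus_puis.rep_eq padd_def)

lemma leading_diff: "leading \<alpha> x b \<Longrightarrow> leading \<alpha> y c \<Longrightarrow> leading \<alpha> (x - y) (b - c)"
  by (simp add: leading_def minus_puis.rep_eq padd_def pneg_def)

text \<open>Exponents in the supports are at most \<alpha> and \<beta>, so no pair sums to more than
  \<alpha> + \<beta>, and only (\<alpha>, \<beta>) can reach that sum.\<close>

lemma leading_mult:
  assumes "leading \<alpha> x b" "leading \<beta> y c"
  shows "leading (\<alpha> + \<beta>) (x * y) (b * c)"
proof -
  let ?f = "Rep_puis x" and ?g = "Rep_puis y"
  let ?S = "\<lambda>q. {(u, v). u + v = q \<and> ?f u \<noteq> 0 \<and> ?g v \<noteq> 0}"
  have le: "u \<le> \<alpha> \<and> v \<le> \<beta>" if "?f u \<noteq> 0" "?g v \<noteq> 0" for u v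
    using assms that unfolding leading_def by (metis not_le)
  have "?S q = {}" if "q > \<alpha> + \<beta>" for q
  proof -
    have "u + v \<noteq> q" if "?f u \<noteq> 0" "?g v \<noteq> 0" for u v
      using le[OF that] \<open>q > \<alpha> + \<beta>\<close> by linarith
    then show ?thesis by blast
  qed
  then have "pmul ?f ?g q = 0" if "q > \<alpha> + \<beta>" for q
    using that unfolding pmul_def by (simp only: sum.empty)
  moreover have "?S (\<alpha> + \<beta>) \<subseteq> {(\<alpha>, \<beta>)}"
  proof clarify
    fix u v assume uv: "u + v = \<alpha> + \<beta>" "?f u \<noteq> 0" "?g v \<noteq> 0"
    with le[OF uv(2,3)] show "u = \<alpha> \<and> v = \<beta>" by linarith
  qed
  then have "pmul ?f ?g (\<alpha> + \<beta>) = (\<Sum>ab\<in>{(\<alpha>, \<beta>)}. ?f (fst ab) * ?g (snd ab))"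
    unfolding pmul_def by (intro sum.mono_neutral_left) auto
  ultimately show ?thesis
    using assms by (simp add: leading_def times_puis.rep_eq)
qed

lemma leading_ex:
  assumes "x \<noteq> 0"
  obtains \<alpha> b where "leading \<alpha> x b" "b \<noteq> 0"
proof -
  have px: "puiseux (Rep_puis x)" using Rep_puis by simp
  obtain N F where N: "N \<ge> 1" and F: "Rep_puis x = ramified N F"
    using px px px by (rule puiseux_common_ramification)
  have F0: "F \<noteq> 0"
    using assms by (auto simp: F Rep_puis_inject[symmetric] zero_puis.rep_eq pzero_ramified[of N])
  let ?d = "fls_subdegree F"
  have "leading (of_int (- ?d) / of_nat N) x (fls_nth F ?d)"
    unfolding leading_def F ramified_of_int_div[OF N]
    using ramified_nonzero_le[OF _ N] by (metis minus_minus not_le)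
  moreover have "fls_nth F ?d \<noteq> 0" using F0 by simp
  ultimately show ?thesis by (rule that)
qed

text \<open>The denominator of \<open>q\<close> serves as ramification index. Monomials rescale
  \<open>P\<close> to leading exponent 0 and realise every prescribed leading term along the
  line.\<close>

lemma leading_monomial_ex: "\<exists>x. leading q x c"
proof -
  obtain k n :: int where kn: "q = of_int k / of_int n" "n > 0"
    by (cases q) (simp add: Fract_of_int_quotient)
  let ?f = "\<lambda>p. if p = q then c else 0"
  have "puiseux ?f"
    unfolding puiseux_def using kn by (intro exI[of _ "nat n"] conjI exI[of _ q]) auto
  then have "leading q (Abs_puis ?f) c" by (simp add: leading_def Abs_puis_inverse)
  then show ?thesis ..
qed

section \<open>Pencils of matrices\<close>

text \<open>Polymorphic counterpart of \<open>cscale\<close>, so that the algebra of pencils is done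
  once for both Puiseux and complex entries.\<close>

definition mscale :: "'a::times \<Rightarrow> 'a^2^2 \<Rightarrow> 'a^2^2" where
  "mscale c A = (\<chi> i j. c * A$i$j)"

lemma mscale_nth [simp]: "mscale c A $ i $ j = c * A $ i $ j"
  by (simp add: mscale_def)

lemma cscale_eq_mscale: "cscale = mscale"
  by (simp add: fun_eq_iff cscale_def mscale_def)

lemma mat2_eq_iff: "A = B \<longleftrightarrow> (\<forall>i j. A $ i $ j = B $ i $ j)" for A B :: "'a^2^2"
  by (simp add: vec_eq_iff)

lemma mscale_simps [simp]:
  fixes A B :: "'a::comm_ring_1^2^2"
  shows "mscale 1 A = A" "mscale 0 A = 0" "mscale a 0 = 0"
    "mscale a (mscale b A) = mscale (a * b) A"
  by (simp_all add: mat2_eq_iff mult.assoc)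

text \<open>The symmetric bilinear form obtained by polarising \<open>det\<close>;
  \<open>detpolar\<close> is its complex instance.\<close>

definition polar :: "'a::comm_ring_1^2^2 \<Rightarrow> 'a^2^2 \<Rightarrow> 'a" where
  "polar X Y = X$1$1 * Y$2$2 + X$2$2 * Y$1$1 - X$1$2 * Y$2$1 - X$2$1 * Y$1$2"

lemma detpolar_eq_polar: "detpolar = polar"
  by (simp add: fun_eq_iff detpolar_def polar_def)

lemma det_comb:
  fixes X Y :: "'a::comm_ring_1^2^2"
  shows "det (mscale a X + mscale b Y) = a * a * det X + a * b * polar X Y + b * b * det Y"
  by (simp add: det_2 polar_def algebra_simps)

lemma det_mscale: "det (mscale a X) = a * a * det X" for X :: "'a::comm_ring_1^2^2"
  by (simp add: det_2 algebra_simps)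

lemma polar_self: "polar X X = 2 * det X"
  by (simp add: polar_def det_2 algebra_simps)

lemma polar_add: "polar X (Y + Z) = polar X Y + polar X Z"
  by (simp add: polar_def algebra_simps)

lemma polar_mscale: "polar (mscale a X) Y = a * polar X Y" "polar X (mscale a Y) = a * polar X Y"
  by (simp_all add: polar_def algebra_simps)

definition combs :: "'a::comm_ring_1^2^2 \<Rightarrow> 'a^2^2 \<Rightarrow> ('a^2^2) set" where
  "combs A B = {mscale a A + mscale b B | a b. a \<noteq> 0 \<or> b \<noteq> 0}"

definition indep :: "'a::comm_ring_1^2^2 \<Rightarrow> 'a^2^2 \<Rightarrow> bool" where
  "indep A B \<longleftrightarrow> (\<forall>a b. mscale a A + mscale b B = 0 \<longrightarrow> a = 0 \<and> b = 0)"

lemma comb_comb: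
  "mscale x (mscale a A + mscale b B) + mscale y (mscale c A + mscale d B) =
   mscale (x * a + y * c) A + mscale (x * b + y * d) B" for A B :: "'a::comm_ring_1^2^2"
  by (simp add: mat2_eq_iff algebra_simps)

text \<open>Cramer's rule for a row vector annihilated by an invertible 2 by 2 matrix.\<close>

lemma unimodular_kernel:
  fixes a b c d :: "'a::field"
  assumes "a * d - b * c \<noteq> 0" "x * a + y * c = 0" "x * b + y * d = 0"
  shows "x = 0 \<and> y = 0"
proof -
  have "x * (a * d - b * c) = (x * a + y * c) * d - (x * b + y * d) * c"
    "y * (a * d - b * c) = (x * b + y * d) * a - (x * a + y * c) * b" by algebra+
  then have "x * (a * d - b * c) = 0" "y * (a * d - b * c) = 0"
    using assms(2,3) by simp_all
  with assms(1) show ?thesis by simp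
qed

text \<open>An invertible substitution keeps nonzero coefficient pairs nonzero, which gives one
  inclusion for every such substitution. The other inclusion is the same fact for the
  inverse.\<close>

lemma combs_basis_change:
  fixes A B :: "'a::field^2^2"
  assumes "a * d - b * c \<noteq> 0"
  shows "combs (mscale a A + mscale b B) (mscale c A + mscale d B) = combs A B"
proof -
  have sub: "combs (mscale a A + mscale b B) (mscale c A + mscale d B) \<subseteq> combs A B"
    if "a * d - b * c \<noteq> 0" for a b c d :: 'a and A B
    unfolding combs_def comb_comb using unimodular_kernel[OF that] by blast
  define D where "D = a * d - b * c"
  have D: "D \<noteq> 0" using assms by (simp add: D_def)
  let ?A = "mscale a A + mscale b B" and ?B = "mscale c A + mscale d B"
  \<comment> \<open>The coefficients are the entries of the inverse matrix.\<close>
  have eqs: "mscale (d / D) ?A + mscale (- b / D) ?B = A"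
    "mscale (- c / D) ?A + mscale (a / D) ?B = B"
    unfolding comb_comb using D by (simp_all add: mat2_eq_iff field_simps) (simp_all add: D_def algebra_simps)
  have "(d / D) * (a / D) - (- b / D) * (- c / D) = 1 / D"
    using D by (simp add: field_simps) (simp add: D_def algebra_simps)
  then have "combs A B \<subseteq> combs ?A ?B"
    using sub[of "d / D" "a / D" "- b / D" "- c / D" ?A ?B] D unfolding eqs by simp
  with sub[OF assms] show ?thesis by blast
qed

lemma indep_basis_change:
  fixes A B :: "'a::field^2^2"
  assumes "a * d - b * c \<noteq> 0" "indep A B"
  shows "indep (mscale a A + mscale b B) (mscale c A + mscale d B)"
  using assms(2) unimodular_kernel[OF assms(1)] unfolding indep_def comb_comb by blast

section \<open>The map VAL on representatives\<close>

definition to_kmat :: "puis^2^2 \<Rightarrow> kmat" where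
  "to_kmat A = (\<chi> i j. Rep_puis (A$i$j))"

lemma kmat_ok_ex:
  assumes "kmat_ok M"
  obtains A where "M = to_kmat A"
proof
  show "M = to_kmat (\<chi> i j. Abs_puis (M$i$j))"
    using assms by (simp add: mat2_eq_iff to_kmat_def kmat_ok_def Abs_puis_inverse)
qed

lemma puiseux_Rep: "puiseux (Rep_puis x)"
  using Rep_puis by simp

lemma puiseux_ex: "puiseux f \<Longrightarrow> \<exists>x. f = Rep_puis x"
  by (metis Abs_puis_inverse mem_Collect_eq)

lemma to_kmat_inject: "to_kmat A = to_kmat B \<longleftrightarrow> A = B"
  by (simp add: to_kmat_def mat2_eq_iff Rep_puis_inject)

lemma to_kmat_hom:
  "kadd (to_kmat A) (to_kmat B) = to_kmat (A + B)"
  "kscale (Rep_puis c) (to_kmat A) = to_kmat (mscale c A)"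
  "kdet (to_kmat A) = Rep_puis (det A)"
  "kzero = to_kmat 0"
  by (simp_all add: mat2_eq_iff to_kmat_def kadd_def kscale_def kdet_def kzero_def det_2
      plus_puis.rep_eq times_puis.rep_eq minus_puis.rep_eq zero_puis.rep_eq)

lemma Rep_puis_eq_iff: "Rep_puis x = pzero \<longleftrightarrow> x = 0" "Rep_puis x = pone \<longleftrightarrow> x = 1"
  by (simp_all add: Rep_puis_inject flip: zero_puis.rep_eq one_puis.rep_eq)

lemma kline_to_kmat: "kline (to_kmat A) (to_kmat B) = to_kmat ` combs A B"
proof
  show "kline (to_kmat A) (to_kmat B) \<subseteq> to_kmat ` combs A B"
  proof
    fix X assume "X \<in> kline (to_kmat A) (to_kmat B)"
    then obtain f g where X: "X = kadd (kscale f (to_kmat A)) (kscale g (to_kmat B))"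
      and fg: "puiseux f" "puiseux g" "f \<noteq> pzero \<or> g \<noteq> pzero"
      unfolding kline_def by blast
    obtain a b where ab: "f = Rep_puis a" "g = Rep_puis b"
      using fg(1,2) puiseux_ex by metis
    have "mscale a A + mscale b B \<in> combs A B"
      using fg(3) unfolding ab Rep_puis_eq_iff combs_def by blast
    then show "X \<in> to_kmat ` combs A B" unfolding X ab to_kmat_hom by (rule imageI)
  qed
  show "to_kmat ` combs A B \<subseteq> kline (to_kmat A) (to_kmat B)"
  proof
    fix X assume "X \<in> to_kmat ` combs A B"
    then obtain a b where "X = kadd (kscale (Rep_puis a) (to_kmat A)) (kscale (Rep_puis b) (to_kmat B))"
      "Rep_puis a \<noteq> pzero \<or> Rep_puis b \<noteq> pzero"
      unfolding combs_def to_kmat_hom Rep_puis_eq_iff by blast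
    then show "X \<in> kline (to_kmat A) (to_kmat B)"
      unfolding kline_def using puiseux_Rep by blast
  qed
qed

text \<open>As with \<open>leading\<close>, \<open>B = 0\<close> is allowed and then only says that
  all exponents lie below \<alpha>; for nonzero \<open>B\<close> the pair is the actual leading
  term.\<close>

definition mleading :: "rat \<Rightarrow> puis^2^2 \<Rightarrow> cmat \<Rightarrow> bool" where
  "mleading \<alpha> A B \<longleftrightarrow> (\<forall>i j. leading \<alpha> (A$i$j) (B$i$j))"

lemma mleading_lead:
  assumes "mleading \<alpha> A B" "B \<noteq> 0"
  shows "lead_exp (to_kmat A) = \<alpha>" "lead_mat (to_kmat A) = B"
proof -
  show *: "lead_exp (to_kmat A) = \<alpha>"
    unfolding lead_exp_def
  proof (rule Greatest_equality)
    show "\<exists>i j. (to_kmat A $ i $ j) \<alpha> \<noteq> 0"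
      using assms by (auto simp: mat2_eq_iff to_kmat_def mleading_def leading_def)
    show "q \<le> \<alpha>" if "\<exists>i j. (to_kmat A $ i $ j) q \<noteq> 0" for q
      using assms that by (auto simp: to_kmat_def mleading_def leading_def not_le[symmetric])
  qed
  show "lead_mat (to_kmat A) = B"
    using assms(1) unfolding lead_mat_def *
    by (simp add: mat2_eq_iff to_kmat_def mleading_def leading_def)
qed

lemma mleading_below: "mleading \<alpha> A B \<Longrightarrow> \<alpha> < \<beta> \<Longrightarrow> mleading \<beta> A 0"
  by (auto simp: mleading_def intro: leading_below)

lemma mleading_add: "mleading \<alpha> A B \<Longrightarrow> mleading \<alpha> A' B' \<Longrightarrow> mleading \<alpha> (A + A') (B + B')"
  by (simp add: mleading_def leading_add)

lemma mleading_mscale: "leading \<beta> c b \<Longrightarrow> mleading \<alpha> A B \<Longrightarrow> mleading (\<beta> + \<alpha>) (mscale c A) (mscale b B)"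
  by (simp add: mleading_def leading_mult)

lemma leading_det: "mleading \<alpha> A B \<Longrightarrow> leading (\<alpha> + \<alpha>) (det A) (det B)"
  unfolding det_2 by (intro leading_diff leading_mult) (auto simp: mleading_def)

lemma leading_polar:
  assumes "mleading \<alpha> A B" "mleading \<beta> A' B'"
  shows "leading (\<alpha> + \<beta>) (polar A A') (polar B B')"
  unfolding polar_def using assms
  by (intro leading_diff leading_add leading_mult) (auto simp: mleading_def)

lemma mleading_ex:
  assumes "A \<noteq> 0"
  obtains \<alpha> B where "mleading \<alpha> A B" "B \<noteq> 0"
proof -
  have "\<exists>\<alpha>. A $ i $ j \<noteq> 0 \<longrightarrow> (\<exists>b. leading \<alpha> (A $ i $ j) b \<and> b \<noteq> 0)" for i j
    using leading_ex by metis
  then obtain e where e: "\<And>i j. A $ i $ j \<noteq> 0 \<Longrightarrow> \<exists>b. leading (e i j) (A $ i $ j) b \<and> b \<noteq> 0"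
    by metis
  \<comment> \<open>Zero entries are left out because \<open>e\<close> is arbitrary there. An entry
    attaining the maximum contributes a nonzero coefficient.\<close>
  let ?E = "(\<lambda>(i, j). e i j) ` {(i, j). A $ i $ j \<noteq> 0}"
  have "finite ?E" by (rule finite_imageI) (rule finite)
  moreover have "?E \<noteq> {}" using assms by (auto simp: mat2_eq_iff)
  ultimately have "Max ?E \<in> ?E" and Max: "\<And>x. x \<in> ?E \<Longrightarrow> x \<le> Max ?E" by auto
  then obtain i0 j0 where ij: "A $ i0 $ j0 \<noteq> 0" "Max ?E = e i0 j0" by auto
  define B where "B = (\<chi> i j. Rep_puis (A $ i $ j) (e i0 j0))"
  have "leading (e i0 j0) (A $ i $ j) (B $ i $ j)" for i j
  proof (cases "A $ i $ j = 0")
    case True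
    then show ?thesis by (simp add: B_def leading_def zero_puis.rep_eq pzero_def)
  next
    case False
    then have "e i j \<in> ?E" by auto
    then have "e i j \<le> e i0 j0" using Max ij(2) by metis
    with e[OF False] show ?thesis by (auto simp: B_def leading_def)
  qed
  then have "mleading (e i0 j0) A B" by (simp add: mleading_def)
  moreover have "B $ i0 $ j0 \<noteq> 0" using e[OF ij(1)] by (auto simp: B_def leading_def)
  then have "B \<noteq> 0" by auto
  ultimately show ?thesis by (rule that)
qed

text \<open>The expression common to \<open>VALm\<close>, \<open>cone_set\<close> and
  \<open>kappa\<close> (the latter at height 0), so that all three can be compared as families of
  such points.\<close>

definition cone_pt :: "real \<Rightarrow> cmat \<Rightarrow> cmat set" where
  "cone_pt \<alpha> B = clsC (exp \<alpha> *\<^sub>R B + exp (- \<alpha>) *\<^sub>R adjstar B)"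

lemma clsC_eq: "clsC B = {mscale c B | c. c \<noteq> 0}"
  by (simp add: clsC_def cscale_eq_mscale)

lemma clsC_mscale:
  assumes c: "c \<noteq> 0"
  shows "clsC (mscale c B) = clsC B"
proof
  show "clsC (mscale c B) \<subseteq> clsC B"
    using c unfolding clsC_eq by fastforce
  show "clsC B \<subseteq> clsC (mscale c B)"
  proof
    fix X assume "X \<in> clsC B"
    then obtain d where "d \<noteq> 0" "X = mscale d B" unfolding clsC_eq by blast
    then have "d / c \<noteq> 0" "X = mscale (d / c) (mscale c B)" using c by simp_all
    then show "X \<in> clsC (mscale c B)" unfolding clsC_eq by blast
  qed
qed

text \<open>\<open>adjstar\<close> is conjugate-linear, so a real factor comes out of both summands
  at once, while a general complex factor does not.\<close>

lemma cone_pt_mscale_real: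
  assumes "\<rho> \<noteq> 0"
  shows "cone_pt \<alpha> (mscale (complex_of_real \<rho>) B) = cone_pt \<alpha> B"
proof -
  have "exp \<alpha> *\<^sub>R mscale (complex_of_real \<rho>) B + exp (- \<alpha>) *\<^sub>R adjstar (mscale (complex_of_real \<rho>) B) =
      mscale (complex_of_real \<rho>) (exp \<alpha> *\<^sub>R B + exp (- \<alpha>) *\<^sub>R adjstar B)"
    by (simp add: mat2_eq_iff forall_2 adjstar_def adjc_def cstar_def mk2_def algebra_simps)
  then show ?thesis unfolding cone_pt_def using assms by (simp add: clsC_mscale)
qed

lemma VALm_singular:
  assumes "det A = 0" "mleading \<alpha> A B" "B \<noteq> 0"
  shows "VALm (to_kmat A) = clsC B"
  using assms by (simp add: VALm_def to_kmat_hom Rep_puis_eq_iff mleading_lead)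

text \<open>The rescaling factor \<open>c\<close> chosen inside \<open>VALm\<close> satisfies
  \<open>(c * k) * (c * k) = 1\<close>, so it recovers \<open>A\<close> up to sign, and
  \<open>cone_pt\<close> does not see the sign.\<close>

lemma VALm_unimodular:
  assumes A: "det A = 1" "mleading \<alpha> A B" "B \<noteq> 0" and k: "k \<noteq> 0"
  shows "VALm (to_kmat (mscale k A)) = cone_pt (real_of_rat \<alpha>) B"
proof -
  let ?M = "to_kmat (mscale k A)"
  define P where "P = (\<lambda>c. puiseux c \<and> pmul (pmul c c) (kdet ?M) = pone)"
  have P_Rep: "P (Rep_puis c) \<longleftrightarrow> (c * k) * (c * k) = 1" for c
    unfolding to_kmat_hom P_def
    by (simp add: puiseux_Rep det_mscale A(1) Rep_puis_eq_iff ac_simps flip: times_puis.rep_eq)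
  \<comment> \<open>A witness, so that the choice operator really returns a normalising
    factor.\<close>
  have "P (Rep_puis (1 / k))" unfolding P_Rep using k by simp
  then have PE: "P (Eps P)" by (rule someI[of P])
  moreover have "P f \<Longrightarrow> \<exists>c. f = Rep_puis c" for f
    unfolding P_def using puiseux_ex by blast
  ultimately obtain c where c: "Eps P = Rep_puis c" by blast
  have "(c * k) * (c * k) = 1" using PE unfolding c P_Rep .
  then have "c * k = 1 \<or> c * k = - 1" by (simp add: square_eq_1_iff)
  then obtain \<epsilon> :: real where "\<epsilon> \<noteq> 0" and lead: "mleading \<alpha> (mscale (c * k) A) (mscale (complex_of_real \<epsilon>) B)"
  proof (elim disjE)
    assume ck: "c * k = - 1"
    have "leading 0 (- 1) (- 1)"
      using leading_diff[of 0 0 0 1 1] by (simp add: leading_0_iff leading_1_iff)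
    from mleading_mscale[OF this A(2)] show ?thesis using that[of "- 1"] ck by simp
  next
    assume "c * k = 1"
    then show ?thesis using that[of 1] A(2) by simp
  qed
  have nz: "mscale (complex_of_real \<epsilon>) B \<noteq> 0"
    using \<open>\<epsilon> \<noteq> 0\<close> A(3) by (auto simp: mat2_eq_iff)
  have "kdet ?M \<noteq> pzero"
    using k by (simp add: to_kmat_hom Rep_puis_eq_iff det_mscale A(1))
  moreover have "(SOME c. puiseux c \<and> pmul (pmul c c) (kdet ?M) = pone) = Rep_puis c"
    using c unfolding P_def .
  ultimately have "VALm ?M = cone_pt (real_of_rat \<alpha>) (mscale (complex_of_real \<epsilon>) B)"
    by (simp only: VALm_def Let_def if_False to_kmat_hom(2) mscale_simps(4)
        mleading_lead[OF lead nz] cone_pt_def)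
  also have "\<dots> = cone_pt (real_of_rat \<alpha>) B"
    by (rule cone_pt_mscale_real) fact
  finally show ?thesis .
qed

section \<open>Lines meeting the quadric once\<close>

lemma is_kline_to_kmat:
  assumes "is_kline M1 M2"
  obtains N1 N2 where "M1 = to_kmat N1" "M2 = to_kmat N2" "indep N1 N2"
proof -
  obtain N1 N2 where N: "M1 = to_kmat N1" "M2 = to_kmat N2"
    using assms kmat_ok_ex unfolding is_kline_def by metis
  have "a = 0 \<and> b = 0" if "mscale a N1 + mscale b N2 = 0" for a b
  proof -
    have "kadd (kscale (Rep_puis a) M1) (kscale (Rep_puis b) M2) = kzero"
      unfolding N to_kmat_hom that ..
    with assms puiseux_Rep have "Rep_puis a = pzero \<and> Rep_puis b = pzero"
      unfolding is_kline_def by blast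
    then show ?thesis unfolding Rep_puis_eq_iff .
  qed
  then have "indep N1 N2" unfolding indep_def by blast
  with N show ?thesis by (rule that)
qed

lemma combs_memI: "a \<noteq> 0 \<or> b \<noteq> 0 \<Longrightarrow> mscale a A + mscale b B \<in> combs A B"
  unfolding combs_def by blast

text \<open>If \<open>polar P N\<close> were nonzero, the line would meet the quadric a second time, at the combination
  of \<open>P\<close> and \<open>N\<close> with coefficients \<open>- det N\<close> and \<open>polar P N\<close>.\<close>
lemma meets_once_tangent:
  assumes line: "is_kline M1 M2" and once: "meets_QK_once M1 M2"
  obtains P N where "kline M1 M2 = to_kmat ` combs P N" "P \<noteq> 0" "det P = 0" "polar P N = 0" "det N \<noteq> 0"
proof -
  obtain N1 N2 where N: "M1 = to_kmat N1" "M2 = to_kmat N2" and ind: "indep N1 N2"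
    using is_kline_to_kmat[OF line] .
  have kl: "kline M1 M2 = to_kmat ` combs N1 N2" unfolding N kline_to_kmat ..
  obtain P' where P': "P' \<in> kline M1 M2" "kdet P' = pzero"
    and unique: "\<And>A. A \<in> kline M1 M2 \<Longrightarrow> kdet A = pzero \<Longrightarrow> \<exists>\<nu>. puiseux \<nu> \<and> A = kscale \<nu> P'"
    using once unfolding meets_QK_once_def by blast
  obtain a b where ab: "a \<noteq> 0 \<or> b \<noteq> 0" and P'_eq: "P' = to_kmat (mscale a N1 + mscale b N2)"
    using P'(1) unfolding kl combs_def by blast
  \<comment> \<open>The second row completes \<open>(a, b)\<close> to an invertible coefficient
    matrix; when \<open>a = 0\<close>, the coefficient \<open>b\<close> is nonzero.\<close>
  define c d :: puis where "c = (if a = 0 then 1 else 0)" and "d = (if a = 0 then 0 else 1)"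
  have cd: "a * d - b * c \<noteq> 0" using ab by (auto simp: c_def d_def)
  define P N where "P = mscale a N1 + mscale b N2" and "N = mscale c N1 + mscale d N2"
  have kl': "kline M1 M2 = to_kmat ` combs P N"
    unfolding kl P_def N_def combs_basis_change[OF cd] ..
  have ind': "indep P N"
    unfolding P_def N_def by (rule indep_basis_change[OF cd ind])
  have P: "det P = 0"
    using P'(2) unfolding P'_eq P_def[symmetric] to_kmat_hom Rep_puis_eq_iff .
  have "P \<noteq> 0"
  proof
    assume "P = 0"
    then have "mscale 1 P + mscale 0 N = 0" by simp
    with ind' show False unfolding indep_def by (metis zero_neq_one)
  qed
  have y0: "y = 0" if "det (mscale x P + mscale y N) = 0" for x y
  proof (rule ccontr)
    \<comment> \<open>Such a point would be a second zero of the determinant; uniqueness makes it a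
      multiple of \<open>P\<close>, against independence.\<close>
    assume y: "y \<noteq> 0"
    then have "to_kmat (mscale x P + mscale y N) \<in> kline M1 M2"
      unfolding kl' by (intro imageI combs_memI) simp
    moreover have "kdet (to_kmat (mscale x P + mscale y N)) = pzero"
      unfolding to_kmat_hom Rep_puis_eq_iff by (rule that)
    ultimately obtain \<nu> where "puiseux \<nu>" "to_kmat (mscale x P + mscale y N) = kscale \<nu> P'"
      using unique by blast
    then obtain v where "to_kmat (mscale x P + mscale y N) = kscale (Rep_puis v) P'"
      using puiseux_ex by metis
    then have "mscale x P + mscale y N = mscale v P"
      unfolding P'_eq P_def[symmetric] to_kmat_hom to_kmat_inject .
    then have "mscale (x - v) P + mscale y N = 0"
      by (simp add: mat2_eq_iff algebra_simps)
    with ind' y show False unfolding indep_def by blast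
  qed
  have "det (mscale (- det N) P + mscale (polar P N) N) = 0"
    unfolding det_comb P by (simp add: algebra_simps)
  then have "polar P N = 0" by (rule y0)
  moreover have "det N \<noteq> 0"
    using y0[of 0 1] by auto
  ultimately show ?thesis using that kl' \<open>P \<noteq> 0\<close> P by blast
qed

text \<open>Subtracting a multiple of \<open>P\<close> from \<open>M\<close> kills an entry where \<open>P\<close> has its leading term; no
  multiple of \<open>P\<close> can then cancel the leading term of \<open>M\<close>.\<close>
lemma kline_normal_form:
  assumes "is_kline M1 M2" "meets_QK_once M1 M2"
  obtains P M P\<^sub>0 B r i j where
    "kline M1 M2 = to_kmat ` combs P M" "det P = 0" "det M = 1" "polar P M = 0"
    "mleading 0 P P\<^sub>0" "mleading r M B" "P\<^sub>0 $ i $ j \<noteq> 0" "B $ i $ j = 0" "B \<noteq> 0"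
proof -
  obtain P N where kl: "kline M1 M2 = to_kmat ` combs P N"
    and P: "P \<noteq> 0" "det P = 0" "polar P N = 0" and N: "det N \<noteq> 0"
    using meets_once_tangent[OF assms] .
  obtain \<alpha> P\<^sub>0 where P0: "mleading \<alpha> P P\<^sub>0" "P\<^sub>0 \<noteq> 0" using mleading_ex[OF P(1)] .
  then obtain i j where ij: "P\<^sub>0 $ i $ j \<noteq> 0" by (auto simp: mat2_eq_iff)
  then have Pij: "P $ i $ j \<noteq> 0"
    using P0(1) unfolding mleading_def by (metis leading_0_iff)
  \<comment> \<open>Scaling by \<open>u\<close> moves the leading exponent of \<open>P\<close> to 0
    and keeps its leading matrix.\<close>
  obtain u where u: "leading (- \<alpha>) u 1" using leading_monomial_ex by blast
  then have u0: "u \<noteq> 0" by (auto simp: leading_0_iff)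
  \<comment> \<open>Adding multiples of \<open>P\<close> does not change the determinant, by
    tangency, so dividing \<open>N\<close> by \<open>s\<close> is enough to get
    \<open>det M = 1\<close>.\<close>
  obtain s where s: "s * s = det N" using puis_sqrt_ex[OF N] by blast
  with N have s0: "s \<noteq> 0" by auto
  \<comment> \<open>The value of \<open>w\<close> for which the \<open>(i, j)\<close> entry of
    \<open>M\<close> vanishes.\<close>
  define w where "w = - (N $ i $ j / (s * P $ i $ j))"
  define M where "M = mscale w P + mscale (1 / s) N"
  have "combs (mscale u P + mscale 0 N) (mscale w P + mscale (1 / s) N) = combs P N"
    by (rule combs_basis_change) (use u0 s0 in simp)
  then have "kline M1 M2 = to_kmat ` combs (mscale u P) M" using kl by (simp add: M_def)
  moreover have "det (mscale u P) = 0" by (simp add: det_mscale P)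
  moreover have "det M = 1"
    using s0 by (simp add: M_def det_comb P field_simps flip: s)
  moreover have "polar (mscale u P) M = 0"
    by (simp add: M_def polar_add polar_mscale P polar_self)
  moreover have "mleading 0 (mscale u P) P\<^sub>0"
    using mleading_mscale[OF u P0(1)] by simp
  moreover have Mij: "M $ i $ j = 0"
    using s0 Pij by (simp add: M_def w_def)
  moreover have "M \<noteq> 0" using \<open>det M = 1\<close> by (auto simp: det_2)
  then obtain r B where B: "mleading r M B" "B \<noteq> 0" using mleading_ex by blast
  moreover have "leading r (M $ i $ j) (B $ i $ j)"
    using B(1) unfolding mleading_def by blast
  then have "B $ i $ j = 0" unfolding Mij leading_0_iff .
  ultimately show ?thesis using ij that by blast
qed

text \<open>Leading coefficients of the three relations: those of 0 vanish, and 1 has its only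
  exponent at 0, which must not exceed \<open>r + r\<close> and contributes to \<open>det B\<close>
  exactly when \<open>r = 0\<close>.\<close>

lemma normal_form_reduction:
  assumes "det P = 0" "det M = 1" "polar P M = 0" "mleading 0 P P\<^sub>0" "mleading r M B"
  shows "r \<ge> 0" "det P\<^sub>0 = 0" "det B = (if r = 0 then 1 else 0)" "polar P\<^sub>0 B = 0"
proof -
  have "leading (r + r) 1 (det B)" using leading_det[OF assms(5)] assms(2) by simp
  then show "r \<ge> 0" "det B = (if r = 0 then 1 else 0)" by (auto simp: leading_1_iff)
  show "det P\<^sub>0 = 0" "polar P\<^sub>0 B = 0"
    using leading_det[OF assms(4)] leading_polar[OF assms(4,5)] assms(1,3)
    by (simp_all add: leading_0_iff)
qed

text \<open>Points other than \<open>P\<close> are represented by \<open>M + s P\<close>. The first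
  set comes from \<open>s\<close> of order at most \<open>r\<close>, the second from
  \<open>s\<close> of larger order, and the third is \<open>P\<close> itself.\<close>

lemma VALm_combs:
  assumes P: "det P = 0" and M: "det M = 1" and PM: "polar P M = 0"
    and P0: "mleading 0 P P\<^sub>0" and B: "mleading r M B"
    and ij: "P\<^sub>0 $ i $ j \<noteq> 0" "B $ i $ j = 0" and "B \<noteq> 0"
  shows "VALm ` to_kmat ` combs P M =
    range (\<lambda>s. cone_pt (real_of_rat r) (B + mscale s P\<^sub>0))
    \<union> {cone_pt (real_of_rat q) (mscale s P\<^sub>0) | q s. q > r \<and> s \<noteq> 0} \<union> {clsC P\<^sub>0}"
    (is "_ = ?R1 \<union> ?R2 \<union> ?R3")
proof -
  have P0_nz: "P\<^sub>0 \<noteq> 0" using ij by auto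
  \<comment> \<open>The \<open>(i, j)\<close> entry of the sum is that of
    \<open>mscale s P\<^sub>0\<close>, so no cancellation can occur.\<close>
  have nz: "B + mscale s P\<^sub>0 \<noteq> 0" for s
  proof (cases "s = 0")
    case False
    then have "(B + mscale s P\<^sub>0) $ i $ j \<noteq> 0" using ij by simp
    then show ?thesis by (metis zero_index)
  qed (use \<open>B \<noteq> 0\<close> in simp)
  have det: "det (M + mscale s P) = 1" for s
    using det_comb[of s P 1 M] by (simp add: P M PM add.commute)
  note VAL = VALm_unimodular[OF det]
  have at: "VALm (to_kmat (mscale b (M + mscale s P))) = cone_pt (real_of_rat r) (B + mscale s\<^sub>0 P\<^sub>0)"
    if "leading r s s\<^sub>0" "b \<noteq> 0" for s s\<^sub>0 b
    using VAL[OF mleading_add[OF B] nz that(2)] mleading_mscale[OF that(1) P0] by simp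
  have above: "VALm (to_kmat (mscale b (M + mscale s P))) = cone_pt (real_of_rat q) (mscale s\<^sub>0 P\<^sub>0)"
    if "leading q s s\<^sub>0" "s\<^sub>0 \<noteq> 0" "q > r" "b \<noteq> 0" for q s s\<^sub>0 b
  proof -
    have "mscale s\<^sub>0 P\<^sub>0 \<noteq> 0" using that(2) P0_nz by (auto simp: mat2_eq_iff)
    with VAL[OF mleading_add[OF mleading_below[OF B that(3)]] _ that(4)] mleading_mscale[OF that(1) P0]
    show ?thesis by simp
  qed
  have infinity: "VALm (to_kmat (mscale a P)) = clsC P\<^sub>0" if a: "a \<noteq> 0" for a
  proof -
    obtain \<alpha> c where c: "leading \<alpha> a c" "c \<noteq> 0" using leading_ex[OF a] .
    have "mscale c P\<^sub>0 \<noteq> 0" using c(2) P0_nz by (auto simp: mat2_eq_iff)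
    then have "VALm (to_kmat (mscale a P)) = clsC (mscale c P\<^sub>0)"
      by (intro VALm_singular[OF _ mleading_mscale[OF c(1) P0]]) (simp add: det_mscale P)
    then show ?thesis using clsC_mscale[OF c(2)] by simp
  qed
  show ?thesis
  proof (intro equalityI subsetI)
    fix z assume "z \<in> VALm ` to_kmat ` combs P M"
    then obtain a b where ab: "a \<noteq> 0 \<or> b \<noteq> 0" and z: "z = VALm (to_kmat (mscale a P + mscale b M))"
      unfolding combs_def by blast
    show "z \<in> ?R1 \<union> ?R2 \<union> ?R3"
    proof (cases "b = 0")
      case True
      then show ?thesis using infinity[of a] ab z by simp
    next
      case False
      define s where "s = a / b"
      have "mscale a P + mscale b M = mscale b (M + mscale s P)"
        using False by (simp add: s_def mat2_eq_iff algebra_simps)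
      then have z: "z = VALm (to_kmat (mscale b (M + mscale s P)))" using z by simp
      \<comment> \<open>The first case includes \<open>s = 0\<close> and all orders below
        \<open>r\<close>, with \<open>s\<^sub>0 = 0\<close>.\<close>
      show ?thesis
      proof (cases "\<exists>s\<^sub>0. leading r s s\<^sub>0")
        case True
        then show ?thesis using at[OF _ False] z by blast
      next
        case nl: False
        then have "s \<noteq> 0" by (auto simp: leading_0_iff)
        then obtain q s\<^sub>0 where q: "leading q s s\<^sub>0" "s\<^sub>0 \<noteq> 0" by (rule leading_ex)
        have "q > r"
        proof (rule ccontr)
          assume "\<not> q > r"
          then have "q = r \<or> q < r" by auto
          with nl q(1) leading_below show False by blast
        qed
        with above[OF q this False] q(2) z show ?thesis by blast
      qed
    qed
  next
    fix z assume "z \<in> ?R1 \<union> ?R2 \<union> ?R3"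
    moreover have mem: "VALm (to_kmat (mscale 1 (M + mscale s P))) \<in> VALm ` to_kmat ` combs P M" for s
      using combs_memI[of s 1 P M] by (simp add: add.commute)
    \<comment> \<open>For the converse, every leading term is realised by a suitable Puiseux
      coefficient.\<close>
    have "cone_pt (real_of_rat r) (B + mscale s P\<^sub>0) \<in> VALm ` to_kmat ` combs P M" for s
      using leading_monomial_ex[of r s] at[of _ s 1] mem by (metis zero_neq_one)
    moreover have "cone_pt (real_of_rat q) (mscale s P\<^sub>0) \<in> VALm ` to_kmat ` combs P M"
      if "q > r" "s \<noteq> 0" for q s
      using leading_monomial_ex[of q s] above[of q _ s 1] mem that by (metis zero_neq_one)
    moreover have "clsC P\<^sub>0 \<in> VALm ` to_kmat ` combs P M"
      using infinity[of 1] combs_memI[of 1 0 P M] by (simp add: image_iff) metis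
    ultimately show "z \<in> VALm ` to_kmat ` combs P M" by blast
  qed
qed

section \<open>Cones over pencils and the section\<close>

lemma clsR_eq: "clsR B = {mscale (complex_of_real r) B | r. r \<noteq> 0}"
  by (simp add: clsR_def cscale_eq_mscale)

lemma mem_clsC: "X \<in> clsC X"
  unfolding clsC_eq by (rule CollectI, rule exI[of _ 1]) simp

lemma mem_clsR: "X \<in> clsR X"
  unfolding clsR_eq by (rule CollectI, rule exI[of _ 1]) simp

lemma clsC_eqD: "clsC X = clsC Y \<Longrightarrow> \<exists>c. c \<noteq> 0 \<and> X = mscale c Y"
  using mem_clsC[of X] unfolding clsC_eq by blast

lemma projS_clsR: "projS (clsR B) = clsC B"
proof -
  have "(SOME X. X \<in> clsR B) \<in> clsR B" using mem_clsR by (rule someI)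
  then obtain r where "r \<noteq> 0" "(SOME X. X \<in> clsR B) = mscale (complex_of_real r) B"
    unfolding clsR_eq by blast
  then show ?thesis unfolding projS_def by (simp add: clsC_mscale)
qed

lemma cone_pt_cong_clsR:
  assumes "clsR X = clsR Y"
  shows "cone_pt \<alpha> X = cone_pt \<alpha> Y"
proof -
  have "X \<in> clsR Y" using mem_clsR[of X] assms by simp
  then obtain r where "r \<noteq> 0" "X = mscale (complex_of_real r) Y"
    unfolding clsR_eq by blast
  then show ?thesis by (simp add: cone_pt_mscale_real)
qed

lemma cone_set_eq: "cone_set I T = {cone_pt \<alpha> B | \<alpha> B. \<alpha> \<in> I \<and> clsR B \<in> T}"
  by (simp add: cone_set_def cone_pt_def)

text \<open>Two representatives of determinant 1 differ by a sign, so the choice inside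
  \<open>kappa\<close> is harmless.\<close>

lemma kappa_clsC:
  assumes X: "det X = 1"
  shows "kappa (clsC X) = cone_pt 0 X"
proof -
  define A where "A = (SOME A. A \<in> clsC X \<and> det A = 1)"
  have "A \<in> clsC X \<and> det A = 1"
    unfolding A_def by (rule someI[of _ X]) (simp add: X mem_clsC)
  then obtain c where c: "A = mscale c X" "det A = 1" unfolding clsC_eq by blast
  then have "c * c = 1" by (simp add: det_mscale X)
  then have "c = 1 \<or> c = - 1" by (simp add: square_eq_1_iff)
  then obtain r :: real where "r \<noteq> 0" "c = complex_of_real r"
    by (metis of_real_1 of_real_minus zero_neq_one neg_equal_0_iff_equal)
  with cone_pt_mscale_real[of r 0 X] show ?thesis
    unfolding kappa_def A_def[symmetric] Let_def c(1) by (simp add: cone_pt_def)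
qed

text \<open>Describes the whole circle over one point: complex multiples of \<open>P\<close>, taken
  modulo real ones.\<close>

lemma clsR_mem_Srest_iff:
  assumes "P \<noteq> 0" "det P = 0"
  shows "clsR X \<in> Srest {clsC P} \<longleftrightarrow> (\<exists>s. s \<noteq> 0 \<and> X = mscale s P)"
proof
  assume "clsR X \<in> Srest {clsC P}"
  then show "\<exists>s. s \<noteq> 0 \<and> X = mscale s P"
    by (intro clsC_eqD) (simp add: Srest_def projS_clsR)
next
  assume "\<exists>s. s \<noteq> 0 \<and> X = mscale s P"
  then obtain s where s: "s \<noteq> 0" "X = mscale s P" by blast
  then have "det X = 0" using assms(2) by (simp add: det_mscale)
  moreover have "X \<noteq> 0" using s assms(1) by (auto simp: mat2_eq_iff)
  ultimately have "clsR X \<in> Sb" unfolding Sb_def by blast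
  then show "clsR X \<in> Srest {clsC P}" using s by (simp add: Srest_def projS_clsR clsC_mscale)
qed

lemma cone_set_Srest:
  assumes "P \<noteq> 0" "det P = 0"
  shows "cone_set {x. x > real_of_rat r \<and> x \<in> \<rat>} (Srest {clsC P}) =
    {cone_pt (real_of_rat q) (mscale s P) | q s. q > r \<and> s \<noteq> 0}"
proof -
  have rat: "x > real_of_rat r \<and> x \<in> \<rat> \<longleftrightarrow> (\<exists>q. x = real_of_rat q \<and> q > r)" for x
    by (auto elim!: Rats_cases simp: of_rat_less)
  show ?thesis
    unfolding cone_set_eq clsR_mem_Srest_iff[OF assms] mem_Collect_eq rat by blast
qed

section \<open>Quotient topologies\<close>

lemma istopology_quotient:
  "istopology (\<lambda>U. U \<subseteq> q ` topspace X \<and> openin X {x \<in> topspace X. q x \<in> U})"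
proof -
  have "openin X {x \<in> topspace X. q x \<in> S \<inter> T}"
    if "openin X {x \<in> topspace X. q x \<in> S}" "openin X {x \<in> topspace X. q x \<in> T}" for S T
    using openin_Int[OF that] by (simp add: Collect_conj_eq Int_ac)
  moreover have "openin X {x \<in> topspace X. q x \<in> \<Union>\<K>}"
    if "\<forall>K\<in>\<K>. openin X {x \<in> topspace X. q x \<in> K}" for \<K>
  proof -
    have "{x \<in> topspace X. q x \<in> \<Union>\<K>} = (\<Union>K\<in>\<K>. {x \<in> topspace X. q x \<in> K})" by blast
    with that show ?thesis by auto
  qed
  ultimately show ?thesis unfolding istopology_def by blast
qed

lemma openin_qtop:
  "openin (qtop X q) U \<longleftrightarrow> U \<subseteq> q ` topspace X \<and> openin X {x \<in> topspace X. q x \<in> U}"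
  unfolding qtop_def by (simp add: topology_inverse'[OF istopology_quotient])

lemma topspace_qtop: "topspace (qtop X q) = q ` topspace X"
proof (rule subset_antisym)
  show "topspace (qtop X q) \<subseteq> q ` topspace X"
    using openin_topspace[of "qtop X q"] unfolding openin_qtop by blast
  have "{x \<in> topspace X. q x \<in> q ` topspace X} = topspace X" by blast
  then have "openin (qtop X q) (q ` topspace X)" unfolding openin_qtop by simp
  then show "q ` topspace X \<subseteq> topspace (qtop X q)" by (rule openin_subset)
qed

text \<open>What the reduction leaves over the complex numbers. The entries \<open>(i, j)\<close>
  and \<open>(k, l)\<close> act as coordinates on the pencil: the first isolates the coefficient of
  \<open>P\<close>, the second then yields that of \<open>B\<close>. The value of
  \<open>det B\<close> is left open, to be 0 or 1 in the two cases.\<close>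

locale tangent_pair =
  fixes P B :: cmat and i j k l :: 2
  assumes Pij: "P $ i $ j \<noteq> 0" and Bij: "B $ i $ j = 0" and Bkl: "B $ k $ l \<noteq> 0"
    and det_P: "det P = 0" and polar_PB: "polar P B = 0"
begin

lemma P_nz: "P \<noteq> 0"
  using Pij by auto

lemma pencil_nz: "B + mscale s P \<noteq> 0"
proof
  assume "B + mscale s P = 0"
  then have "(B + mscale s P) $ i $ j = 0" "(B + mscale s P) $ k $ l = 0" by simp_all
  then show False using Pij Bij Bkl by simp
qed

lemma det_pencil: "det (B + mscale s P) = det B"
  using det_comb[of s P 1 B] by (simp add: det_P polar_PB add.commute)

lemma indep: "indep P B"
  unfolding indep_def
proof (intro allI impI)
  fix a b assume "mscale a P + mscale b B = 0"
  then have "(mscale a P + mscale b B) $ i $ j = 0" "(mscale a P + mscale b B) $ k $ l = 0"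
    by simp_all
  then show "a = 0 \<and> b = 0" using Pij Bij Bkl by simp
qed

lemma cline_eq: "cline P B = clsC ` combs P B"
  unfolding cline_def combs_def cscale_eq_mscale by blast

lemma is_cline: "is_cline (cline P B)"
  using indep unfolding is_cline_def indep_def cscale_eq_mscale by blast

lemma vertex_mem: "clsC P \<in> cline P B"
  unfolding cline_eq using combs_memI[of 1 0 P B] by (intro image_eqI[of _ _ P]) simp_all

text \<open>Away from the vertex the coefficient of \<open>B\<close> is nonzero and can be scaled to
  1, leaving the affine coordinate \<open>s = a / b\<close>.\<close>

lemma affine_part: "cline P B - {clsC P} = range (\<lambda>s. clsC (B + mscale s P))"
proof (intro equalityI subsetI)
  fix z assume "z \<in> cline P B - {clsC P}"
  then obtain a b where z: "z = clsC (mscale a P + mscale b B)" "z \<noteq> clsC P" "a \<noteq> 0 \<or> b \<noteq> 0"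
    unfolding cline_eq combs_def by blast
  then have b: "b \<noteq> 0" by (auto simp: clsC_mscale)
  then have "mscale a P + mscale b B = mscale b (B + mscale (a / b) P)"
    by (simp add: mat2_eq_iff algebra_simps)
  with z(1) b show "z \<in> range (\<lambda>s. clsC (B + mscale s P))" by (auto simp: clsC_mscale)
next
  fix z assume "z \<in> range (\<lambda>s. clsC (B + mscale s P))"
  then obtain s where z: "z = clsC (B + mscale s P)" by blast
  have "z \<in> cline P B"
    unfolding z cline_eq using combs_memI[of s 1 P B] by (simp add: add.commute)
  moreover have "z \<noteq> clsC P"
  proof
    assume "z = clsC P"
    then obtain c where "B + mscale s P = mscale c P" unfolding z using clsC_eqD by blast
    then have "mscale (s - c) P + mscale 1 B = 0" by (simp add: mat2_eq_iff algebra_simps)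
    with indep show False unfolding indep_def by (metis zero_neq_one)
  qed
  ultimately show "z \<in> cline P B - {clsC P}" by blast
qed

text \<open>The coefficients of \<open>P\<close> and \<open>B\<close> are extended to linear forms on all matrices, so that the section
  becomes the restriction of a map defined on an open subset of \<open>\<complex>P\<^sup>3\<close>.\<close>

definition coeffP :: "cmat \<Rightarrow> complex" where
  "coeffP X = X $ i $ j / P $ i $ j"

definition coeffB :: "cmat \<Rightarrow> complex" where
  "coeffB X = (X $ k $ l - coeffP X * P $ k $ l) / B $ k $ l"

text \<open>Homogeneous of degree 0, hence a function of the complex class, with values in the
  affine pencil even for \<open>X\<close> off the line.\<close>

definition normalise :: "cmat \<Rightarrow> cmat" where
  "normalise X = B + mscale (coeffP X / coeffB X) P"

lemma coeff_pencil: "coeffP (B + mscale s P) = s" "coeffB (B + mscale s P) = 1"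
  using Pij Bij Bkl by (simp_all add: coeffP_def coeffB_def)

lemma coeff_mscale: "coeffP (mscale c X) = c * coeffP X" "coeffB (mscale c X) = c * coeffB X"
  by (simp_all add: coeffP_def coeffB_def algebra_simps)

lemma normalise_pencil: "normalise (B + mscale s P) = B + mscale s P"
  by (simp add: normalise_def coeff_pencil)

lemma normalise_mscale: "c \<noteq> 0 \<Longrightarrow> normalise (mscale c X) = normalise X"
  by (simp add: normalise_def coeff_mscale)

lemma continuous_on_normalise: "continuous_on {X. coeffB X \<noteq> 0} normalise"
  unfolding normalise_def mscale_def coeffB_def coeffP_def
  using Pij Bkl by (intro continuous_intros) auto

lemma open_coeffB: "open {X. coeffB X \<noteq> 0}"
  unfolding coeffB_def coeffP_def
  using Pij Bkl by (intro open_Collect_neq continuous_intros) auto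

definition sect :: "cmat set \<Rightarrow> cmat set" where
  "sect z = clsR (normalise (SOME X. X \<in> z))"

lemma sect_clsC: "sect (clsC X) = clsR (normalise X)"
proof -
  have "(SOME Y. Y \<in> clsC X) \<in> clsC X" using mem_clsC by (rule someI)
  then obtain c where "c \<noteq> 0" "(SOME Y. Y \<in> clsC X) = mscale c X"
    unfolding clsC_eq by blast
  then show ?thesis unfolding sect_def by (simp add: normalise_mscale)
qed

section \<open>The case \<open>det B = 0\<close>: the line lies in the quadric and carries a
  section\<close>

context
  assumes det_B: "det B = 0"
begin

lemma cline_subset_Qc: "cline P B \<subseteq> Qc"
proof
  fix z assume z: "z \<in> cline P B"
  show "z \<in> Qc"
  proof (cases "z = clsC P")
    case True
    then show ?thesis using P_nz det_P unfolding Qc_def by blast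
  next
    case False
    then have "z \<in> cline P B - {clsC P}" using z by blast
    then obtain s where "z = clsC (B + mscale s P)" unfolding affine_part by blast
    then show ?thesis using pencil_nz det_pencil det_B unfolding Qc_def by force
  qed
qed

text \<open>The set of matrices is open because \<open>normalise\<close> is continuous where
  \<open>coeffB\<close> is nonzero and takes values in the nonzero singular matrices. It is stable
  under nonzero scalars, so its image is open in the quotient.\<close>

lemma open_domain_sect:
  assumes V: "openin S_top V"
  shows "openin CP3_top (clsC ` {X. coeffB X \<noteq> 0 \<and> clsR (normalise X) \<in> V})"
proof -
  let ?D = "{Y :: cmat. Y \<noteq> 0 \<and> det Y = 0}"
  let ?W = "{X. coeffB X \<noteq> 0 \<and> clsR (normalise X) \<in> V}"
  have D: "normalise X \<in> ?D" for X
    using pencil_nz det_pencil det_B by (simp add: normalise_def)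
  have "openin (top_of_set ?D) {Y \<in> ?D. clsR Y \<in> V}"
    using V unfolding S_top_def openin_qtop by simp
  moreover have "normalise \<in> {X. coeffB X \<noteq> 0} \<rightarrow> ?D" using D by blast
  ultimately have "openin (top_of_set {X. coeffB X \<noteq> 0}) ({X. coeffB X \<noteq> 0} \<inter> normalise -` {Y \<in> ?D. clsR Y \<in> V})"
    by (intro continuous_openin_preimage[OF continuous_on_normalise])
  moreover have "{X. coeffB X \<noteq> 0} \<inter> normalise -` {Y \<in> ?D. clsR Y \<in> V} = ?W"
    using D by blast
  ultimately have "open ?W"
    using openin_open_trans[OF _ open_coeffB] by simp
  have W_nz: "0 \<notin> ?W" by (simp add: coeffB_def coeffP_def)
  have "X \<in> ?W" if X: "clsC X \<in> clsC ` ?W" for X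
  proof -
    obtain Y where Y: "Y \<in> ?W" "clsC X = clsC Y" using X by blast
    then obtain c where "c \<noteq> 0" "X = mscale c Y" using clsC_eqD by blast
    with Y(1) show ?thesis by (simp add: coeff_mscale normalise_mscale)
  qed
  then have "{X \<in> - {0}. clsC X \<in> clsC ` ?W} = ?W" using W_nz by blast
  moreover have "openin (top_of_set (- {0})) ?W"
    using W_nz by (intro open_openin_trans \<open>open ?W\<close>) auto
  moreover have "clsC ` ?W \<subseteq> clsC ` (- {0})" using W_nz by blast
  ultimately show ?thesis unfolding CP3_top_def openin_qtop by simp
qed

lemma is_section_sect: "is_section sect (cline P B - {clsC P})"
proof -
  let ?Z = "cline P B - {clsC P}"
  have sect: "sect z \<in> Sb \<and> projS (sect z) = z" if "z \<in> ?Z" for z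
  proof -
    from that obtain s where z: "z = clsC (B + mscale s P)" unfolding affine_part by blast
    have "sect z = clsR (B + mscale s P)" unfolding z sect_clsC normalise_pencil ..
    moreover have "clsR (B + mscale s P) \<in> Sb"
      using pencil_nz det_pencil det_B unfolding Sb_def by force
    ultimately show ?thesis by (simp add: z projS_clsR)
  qed
  have "continuous_map (subtopology CP3_top ?Z) S_top sect"
    unfolding continuous_map_def
  proof (intro conjI allI impI)
    show "sect \<in> topspace (subtopology CP3_top ?Z) \<rightarrow> topspace S_top"
      using sect by (auto simp: S_top_def topspace_qtop Sb_def)
  next
    fix V assume V: "openin S_top V"
    let ?U = "clsC ` {X. coeffB X \<noteq> 0 \<and> clsR (normalise X) \<in> V}"
    \<comment> \<open>Every point of the punctured line has a representative
      \<open>B + mscale s P\<close>, where \<open>coeffB\<close> is 1. Hence the open set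
      \<open>?U\<close> cuts out exactly the preimage of \<open>V\<close>.\<close>
    have "z \<in> ?U \<longleftrightarrow> sect z \<in> V" if z: "z \<in> ?Z" for z
    proof
      show "sect z \<in> V" if "z \<in> ?U" using that by (auto simp: sect_clsC)
      assume V: "sect z \<in> V"
      obtain s where "z = clsC (B + mscale s P)" using z unfolding affine_part by blast
      with V show "z \<in> ?U"
        by (intro image_eqI[of _ _ "B + mscale s P"]) (simp_all add: sect_clsC coeff_pencil)
    qed
    then have "{z \<in> topspace (subtopology CP3_top ?Z). sect z \<in> V} = topspace CP3_top \<inter> ?U \<inter> ?Z"
      by auto
    moreover have "topspace CP3_top \<inter> ?U = ?U"
      using openin_subset[OF open_domain_sect[OF V]] by blast
    ultimately show "openin (subtopology CP3_top ?Z) {z \<in> topspace (subtopology CP3_top ?Z). sect z \<in> V}"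
      using open_domain_sect[OF V] by (simp add: openin_subtopology_Int)
  qed
  with sect cline_subset_Qc show ?thesis unfolding is_section_def by blast
qed

lemma cone_set_sect:
  "cone_set {r} (sect ` (cline P B - {clsC P})) = range (\<lambda>s. cone_pt r (B + mscale s P))"
proof -
  have "sect ` (cline P B - {clsC P}) = range (\<lambda>s. clsR (B + mscale s P))"
    unfolding affine_part image_image sect_clsC normalise_pencil ..
  then have "cone_set {r} (sect ` (cline P B - {clsC P})) =
      {cone_pt r X | X. \<exists>s. clsR X = clsR (B + mscale s P)}"
    unfolding cone_set_eq by (simp add: image_iff)
  \<comment> \<open>\<open>cone_set\<close> admits every real representative of a class, and all of
    them give the same cone point.\<close>
  also have "\<dots> = range (\<lambda>s. cone_pt r (B + mscale s P))"
    using cone_pt_cong_clsR by blast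
  finally show ?thesis .
qed

end

section \<open>The case \<open>det B = 1\<close>: the line is tangent to the quadric\<close>

context
  assumes det_B: "det B = 1"
begin

lemma tangent_at_cline: "tangent_at (cline P B) (clsC P)"
proof -
  have "clsC P \<in> Qc" using P_nz det_P unfolding Qc_def by blast
  moreover have "\<not> cline P B \<subseteq> Qc"
  proof
    assume "cline P B \<subseteq> Qc"
    \<comment> \<open>The point of \<open>B\<close> lies off the quadric, since its determinant is
      1.\<close>
    moreover have "clsC B \<in> cline P B"
      using combs_memI[of 0 1 P B] unfolding cline_eq by simp
    ultimately obtain X where X: "det X = 0" "clsC B = clsC X" unfolding Qc_def by blast
    then obtain c where "B = mscale c X" using clsC_eqD by blast
    then show False using X(1) det_B by (simp add: det_mscale)
  qed
  moreover have "detpolar P' X = 0" if z: "z \<in> cline P B" "P' \<in> clsC P" "X \<in> z" for z P' X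
  proof -
    obtain a b c d where "P' = mscale c P" "X = mscale d (mscale a P + mscale b B)"
      using z unfolding cline_eq combs_def clsC_eq by blast
    then show ?thesis
      by (simp add: detpolar_eq_polar polar_mscale polar_add polar_self det_P polar_PB)
  qed
  ultimately show ?thesis unfolding tangent_at_def using is_cline vertex_mem by blast
qed

lemma kappa_image: "kappa ` (cline P B - {clsC P}) = range (\<lambda>s. cone_pt 0 (B + mscale s P))"
proof -
  have "kappa (clsC (B + mscale s P)) = cone_pt 0 (B + mscale s P)" for s
    by (rule kappa_clsC) (simp add: det_pencil det_B)
  then show ?thesis unfolding affine_part image_image by simp
qed

end

end

section \<open>Assembly of the two cases\<close>

theorem theorem4p1:
  fixes M1 M2 :: kmat
  assumes "is_kline M1 M2"
    and "meets_QK_once M1 M2"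
  shows "(\<exists>r l p \<sigma>. r > 0 \<and> is_cline l \<and> l \<subseteq> Qc \<and> p \<in> l \<and> is_section \<sigma> (l - {p}) \<and>
            VALm ` kline M1 M2 =
              cone_set {r} (\<sigma> ` (l - {p})) \<union> cone_set {x. x > r \<and> x \<in> \<rat>} (Srest {p}) \<union> {p})
       \<or> (\<exists>l p. tangent_at l p \<and>
            VALm ` kline M1 M2 =
              kappa ` (l - {p}) \<union> cone_set {x. x > 0 \<and> x \<in> \<rat>} (Srest {p}) \<union> {p})"
proof -
  obtain P M P\<^sub>0 B r i j where kl: "kline M1 M2 = to_kmat ` combs P M"
    and nf: "det P = 0" "det M = 1" "polar P M = 0" "mleading 0 P P\<^sub>0" "mleading r M B"
    and ij: "P\<^sub>0 $ i $ j \<noteq> 0" "B $ i $ j = 0" and "B \<noteq> 0"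
    using kline_normal_form[OF assms] .
  note red = normal_form_reduction[OF nf]
  obtain k l where "B $ k $ l \<noteq> 0" using \<open>B \<noteq> 0\<close> by (auto simp: mat2_eq_iff)
  then interpret tangent_pair P\<^sub>0 B i j k l
    using ij red by unfold_locales
  have VAL: "VALm ` kline M1 M2 =
      range (\<lambda>s. cone_pt (real_of_rat r) (B + mscale s P\<^sub>0))
      \<union> cone_set {x. x > real_of_rat r \<and> x \<in> \<rat>} (Srest {clsC P\<^sub>0}) \<union> {clsC P\<^sub>0}"
    unfolding kl VALm_combs[OF nf ij \<open>B \<noteq> 0\<close>] cone_set_Srest[OF P_nz det_P] ..
  show ?thesis
  \<comment> \<open>The line is \<open>cline P\<^sub>0 B\<close> and the point is
    \<open>clsC P\<^sub>0\<close> in both cases; \<open>r\<close> decides whether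
    \<open>det B\<close> is 1 or 0.\<close>
  proof (cases "r = 0")
    case True
    then have det_B: "det B = 1" using red by simp
    have "VALm ` kline M1 M2 = kappa ` (cline P\<^sub>0 B - {clsC P\<^sub>0})
        \<union> cone_set {x. x > 0 \<and> x \<in> \<rat>} (Srest {clsC P\<^sub>0}) \<union> {clsC P\<^sub>0}"
      using VAL unfolding kappa_image[OF det_B] True of_rat_0 .
    with tangent_at_cline[OF det_B] show ?thesis by blast
  next
    case False
    then have det_B: "det B = 0" and r: "real_of_rat r > 0" using red by simp_all
    have "VALm ` kline M1 M2 = cone_set {real_of_rat r} (sect ` (cline P\<^sub>0 B - {clsC P\<^sub>0}))
        \<union> cone_set {x. x > real_of_rat r \<and> x \<in> \<rat>} (Srest {clsC P\<^sub>0}) \<union> {clsC P\<^sub>0}"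
      using VAL unfolding cone_set_sect[OF det_B] .
    with r is_cline cline_subset_Qc[OF det_B] vertex_mem is_section_sect[OF det_B]
    show ?thesis by blast
  qed
qed

end
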